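(* Let $(X,\mathbb{F})$ and $(Y,\mathbb{G})$ be non-autonomous dynamical systems generated by $\mathbb{F}=\{f_n:n\in\mathbb{N}\}$ and $\mathbb{G}=\{g_n:n\in\mathbb{N}\}$ respectively. If $(g_n)$ converges uniformly to a map $g$, then for all $x_1,x_2\in X$ and $y_1,y_2\in Y$: $((x_1,x_2),(y_1,y_2))\in L(X,\mathbb{F})\times L(Y,\mathbb{G})$ if and only if $((x_1,y_1),(x_2,y_2))\in L(X\times Y,\mathbb{F}\times\mathbb{G})$.
   Context: A non-autonomous system $(X,\mathbb{F})$ consists of a compact metric space $(X,d_X)$ and a sequence $\mathbb{F}=(f_n)_{n\ge 1}$ of surjective continuous self-maps of $X$; $\omega_n=f_n\circ\cdots\circ f_1$. The product system $(X\times Y,\mathbb{F}\times\mathbb{G})$ is generated by the maps $f_n\times g_n$ on $X\times Y$ with the product (e.g. maximum) metric. A set $S=\{s_n:n\in\mathbb{N}\}\subseteq\mathbb{N}$ (with $s_1<s_2<\cdots$) is syndetic if there is $M\in\mathbb{N}$ with $|s_{n+1}-s_n|\le M$ for all $n$. For any non-autonomous system $(X,\mathbb{F})$, $L(X,\mathbb{F})$ is the set of syndetically proximal pairs, i.e. pairs $(x,y)\in X\times X$ such that for every $\epsilon>0$ the set $\{n\in\mathbb{N}: d_X(\omega_n(x),\omega_n(y))<\epsilon\}$ is syndetic. *)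

theory Defs
  imports "HOL-Analysis.Analysis"
begin

text \<open>
  Sequences of maps are indexed from 1, so the value \<open>f 0\<close> of a
  sequence \<open>f\<close> of self-maps is never used. Metric spaces are given by a carrier and a distance.
\<close>

definition nonautonomous_system :: "'a set \<Rightarrow> ('a \<Rightarrow> 'a \<Rightarrow> real) \<Rightarrow> (nat \<Rightarrow> 'a \<Rightarrow> 'a) \<Rightarrow> bool" where
  "nonautonomous_system X d f \<longleftrightarrow>
     Metric_space X d \<and>
     compact_space (Metric_space.mtopology X d) \<and>
     (\<forall>n\<ge>1. continuous_map (Metric_space.mtopology X d) (Metric_space.mtopology X d) (f n) \<and>
            f n ` X = X)"

primrec omega :: "(nat \<Rightarrow> 'a \<Rightarrow> 'a) \<Rightarrow> nat \<Rightarrow> 'a \<Rightarrow> 'a" where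
  "omega f 0 = id"
| "omega f (Suc n) = f (Suc n) \<circ> omega f n"

text \<open>A syndetic set is in particular infinite: it is the range of a strictly increasing sequence.\<close>

definition syndetic :: "nat set \<Rightarrow> bool" where
  "syndetic S \<longleftrightarrow>
     (\<exists>s. strict_mono s \<and> S = range s \<and> (\<exists>M. \<forall>n. s (Suc n) - s n \<le> M))"

definition synd_proximal :: "'a set \<Rightarrow> ('a \<Rightarrow> 'a \<Rightarrow> real) \<Rightarrow> (nat \<Rightarrow> 'a \<Rightarrow> 'a) \<Rightarrow> ('a \<times> 'a) set" where
  "synd_proximal X d f =
     {(x, y). x \<in> X \<and> y \<in> X \<and>
        (\<forall>\<epsilon>>0. syndetic {n. 1 \<le> n \<and> d (omega f n x) (omega f n y) < \<epsilon>})}"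

definition max_dist ::
    "('a \<Rightarrow> 'a \<Rightarrow> real) \<Rightarrow> ('b \<Rightarrow> 'b \<Rightarrow> real) \<Rightarrow> 'a \<times> 'b \<Rightarrow> 'a \<times> 'b \<Rightarrow> real" where
  "max_dist d d' p q = max (d (fst p) (fst q)) (d' (snd p) (snd q))"

definition product_maps ::
    "(nat \<Rightarrow> 'a \<Rightarrow> 'a) \<Rightarrow> (nat \<Rightarrow> 'b \<Rightarrow> 'b) \<Rightarrow> nat \<Rightarrow> 'a \<times> 'b \<Rightarrow> 'a \<times> 'b" where
  "product_maps f g n = map_prod (f n) (g n)"

definition converges_uniformly ::
    "'a set \<Rightarrow> ('a \<Rightarrow> 'a \<Rightarrow> real) \<Rightarrow> (nat \<Rightarrow> 'a \<Rightarrow> 'a) \<Rightarrow> ('a \<Rightarrow> 'a) \<Rightarrow> bool" where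
  "converges_uniformly X d g h \<longleftrightarrow>
     (\<forall>\<epsilon>>0. \<forall>\<^sub>F n in sequentially. \<forall>x\<in>X. d (g n x) (h x) < \<epsilon>)"

lemma Metric_space_max_dist:
  assumes "Metric_space X d" "Metric_space Y d'"
  shows "Metric_space (X \<times> Y) (max_dist d d')"
proof -
  interpret A: Metric_space X d by fact
  interpret B: Metric_space Y d' by fact
  show ?thesis
  proof
    fix p q show "0 \<le> max_dist d d' p q"
      by (simp add: max_dist_def le_max_iff_disj)
    show "max_dist d d' p q = max_dist d d' q p"
      by (simp add: max_dist_def A.commute B.commute)
  next
    fix p q assume "p \<in> X \<times> Y" "q \<in> X \<times> Y"
    then show "max_dist d d' p q = 0 \<longleftrightarrow> p = q"
      using A.zero[of "fst p" "fst q"] B.zero[of "snd p" "snd q"]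
        A.nonneg[of "fst p" "fst q"] B.nonneg[of "snd p" "snd q"]
      unfolding max_dist_def prod_eq_iff mem_Times_iff by (smt (verit))
  next
    fix p q r assume "p \<in> X \<times> Y" "q \<in> X \<times> Y" "r \<in> X \<times> Y"
    then show "max_dist d d' p r \<le> max_dist d d' p q + max_dist d d' q r"
      using A.triangle[of "fst p" "fst q" "fst r"] B.triangle[of "snd p" "snd q" "snd r"]
      by (auto simp: max_dist_def max_def)
  qed
qed

lemma mtopology_max_dist:
  assumes "Metric_space X d" "Metric_space Y d'"
  shows "Metric_space.mtopology (X \<times> Y) (max_dist d d') =
         prod_topology (Metric_space.mtopology X d) (Metric_space.mtopology Y d')"
proof -
  interpret A: Metric_space X d by fact
  interpret B: Metric_space Y d' by fact
  interpret P: Metric_space "X \<times> Y" "max_dist d d'"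
    using assms by (rule Metric_space_max_dist)
  have ball: "P.mball (x, y) e = A.mball x e \<times> B.mball y e" for x y e
    by (auto simp: P.mball_def A.mball_def B.mball_def max_dist_def)
  have "openin P.mtopology U \<longleftrightarrow> openin (prod_topology A.mtopology B.mtopology) U" for U
  proof
    assume U: "openin P.mtopology U"
    show "openin (prod_topology A.mtopology B.mtopology) U"
      unfolding openin_prod_topology_alt
    proof (intro allI impI)
      fix x y assume xy: "(x, y) \<in> U"
      then obtain e where "e > 0" "P.mball (x, y) e \<subseteq> U"
        using U unfolding P.openin_mtopology by blast
      moreover have "x \<in> X" "y \<in> Y"
        using U xy unfolding P.openin_mtopology by auto
      ultimately show "\<exists>V W. openin A.mtopology V \<and> openin B.mtopology W \<and>
          x \<in> V \<and> y \<in> W \<and> V \<times> W \<subseteq> U"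
        unfolding ball
        by (intro exI[of _ "A.mball x e"] exI[of _ "B.mball y e"]) auto
    qed
  next
    assume U: "openin (prod_topology A.mtopology B.mtopology) U"
    have "\<exists>e>0. P.mball p e \<subseteq> U" if "p \<in> U" for p
    proof -
      obtain x y where p: "p = (x, y)" by (cases p)
      obtain V W where V: "openin A.mtopology V" "x \<in> V" and W: "openin B.mtopology W" "y \<in> W"
        and VW: "V \<times> W \<subseteq> U"
        using U \<open>p \<in> U\<close> unfolding p openin_prod_topology_alt by meson
      obtain r where r: "r > 0" "A.mball x r \<subseteq> V"
        using V unfolding A.openin_mtopology by blast
      obtain s where s: "s > 0" "B.mball y s \<subseteq> W"
        using W unfolding B.openin_mtopology by blast
      have "A.mball x (min r s) \<subseteq> V" "B.mball y (min r s) \<subseteq> W"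
        using r s A.mball_subset_concentric[of "min r s" r x]
          B.mball_subset_concentric[of "min r s" s y] by auto
      then show ?thesis
        using r s VW unfolding p ball by (intro exI[of _ "min r s"]) auto
    qed
    moreover have "U \<subseteq> X \<times> Y"
      using openin_subset[OF U] by simp
    ultimately show "openin P.mtopology U"
      unfolding P.openin_mtopology by blast
  qed
  then show ?thesis
    by (simp add: topology_eq)
qed

lemma nonautonomous_system_product:
  assumes "nonautonomous_system X d f" "nonautonomous_system Y d' g"
  shows "nonautonomous_system (X \<times> Y) (max_dist d d') (product_maps f g)"
proof -
  have M: "Metric_space X d" "Metric_space Y d'"
    using assms by (auto simp: nonautonomous_system_def)
  let ?A = "Metric_space.mtopology X d" and ?B = "Metric_space.mtopology Y d'"
  have "continuous_map (prod_topology ?A ?B) (prod_topology ?A ?B) (product_maps f g n)"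
    if "n \<ge> 1" for n
  proof -
    have "continuous_map ?A ?A (f n)" "continuous_map ?B ?B (g n)"
      using assms that by (auto simp: nonautonomous_system_def)
    then show ?thesis
      by (simp add: product_maps_def map_prod_def continuous_map_prod_top)
  qed
  moreover have "product_maps f g n ` (X \<times> Y) = X \<times> Y" if "n \<ge> 1" for n
    using assms that by (simp add: nonautonomous_system_def product_maps_def map_prod_surj_on)
  moreover have "compact_space (prod_topology ?A ?B)"
    using assms by (simp add: nonautonomous_system_def compact_space_prod_topology)
  ultimately show ?thesis
    using Metric_space_max_dist[OF M]
    unfolding nonautonomous_system_def mtopology_max_dist[OF M] by blast
qed

end

theory Submission
  imports Defs
begin

text \<open>
  Only the joint return times need an argument. Since \<open>(g\<^sub>n)\<close> converges uniformly, its tail is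
  uniformly equicontinuous, hence so are the compositions of a bounded number of consecutive
  late maps. If \<open>L\<close> bounds the gaps of the return times in \<open>X\<close>, choose \<open>\<delta>\<close> so that
  two late orbits in \<open>Y\<close> that are \<open>\<delta>\<close>-close stay \<open>\<epsilon>\<close>-close for the next
  \<open>L\<close> steps: within these steps there is a return time in \<open>X\<close>, and the \<open>\<delta>\<close>-close
  times in \<open>Y\<close> are themselves syndetic.
\<close>

text \<open>Windows of fixed length are easier to intersect and compare than enumerations; this
  lemma and the next translate between the two.\<close>

lemma syndetic_if_eventually_bounded_gaps:
  assumes "\<And>k. k \<ge> N \<Longrightarrow> \<exists>n\<in>S. k \<le> n \<and> n \<le> k + M"
  shows "syndetic S"
proof -
  \<comment> \<open>Starting the search at \<open>k + N\<close> makes the hypothesis available for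
    every \<open>k\<close>, at the price of a window longer by \<open>N\<close>.\<close>
  have gap: "\<exists>n\<in>S. k \<le> n \<and> n \<le> k + (N + M)" for k
    using assms[of "k + N", OF le_add2] by (elim bexE, intro bexI) auto
  have inf: "infinite S"
    unfolding infinite_nat_iff_unbounded_le using gap by blast
  \<comment> \<open>The extra \<open>Suc\<close> arises because the window must start strictly after
    the current element.\<close>
  have "enumerate S (Suc n) - enumerate S n \<le> Suc (N + M)" for n
  proof -
    obtain m where "m \<in> S" "Suc (enumerate S n) \<le> m" "m \<le> Suc (enumerate S n) + (N + M)"
      using gap by blast
    moreover have "enumerate S (Suc n) \<le> m"
      using calculation inf by (simp add: enumerate_Suc'' Least_le)
    ultimately show ?thesis by linarith
  qed
  then show ?thesis
    unfolding syndetic_def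
    using inf by (metis range_enumerate strict_mono_enumerate)
qed

lemma syndetic_bounded_gaps:
  assumes "syndetic S"
  obtains M where "\<And>k. \<exists>n\<in>S. k \<le> n \<and> n \<le> k + M"
proof -
  obtain s M where s: "strict_mono s" "S = range s" and M: "\<And>n. s (Suc n) - s n \<le> M"
    using assms unfolding syndetic_def by blast
  \<comment> \<open>The gap bound says nothing about the first element, so \<open>s 0\<close> is
    added to cover the case where \<open>s 0\<close> is the first term reaching
    \<open>k\<close>.\<close>
  have "\<exists>n\<in>S. k \<le> n \<and> n \<le> k + (s 0 + M)" for k
  proof -
    define n where "n = (LEAST n. k \<le> s n)"
    have k: "k \<le> s n"
      unfolding n_def using s(1) by (metis LeastI strict_mono_imp_increasing)
    have "s n \<le> k + (s 0 + M)"
    proof (cases n)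
      case (Suc m)
      then have "s m < k"
        unfolding n_def by (metis lessI not_le not_less_Least)
      then show ?thesis using M[of m] Suc by simp
    qed simp
    then show ?thesis using k s(2) by blast
  qed
  then show thesis by (rule that)
qed

lemma syndetic_mono:
  assumes "syndetic S" "S \<subseteq> T"
  shows "syndetic T"
proof -
  obtain M where "\<And>k. \<exists>n\<in>S. k \<le> n \<and> n \<le> k + M"
    using syndetic_bounded_gaps[OF assms(1)] by blast
  then show ?thesis
    using assms(2) by (intro syndetic_if_eventually_bounded_gaps[of 0 T M]) blast
qed

lemma omega_product_maps:
  "omega (product_maps f g) n p = (omega f n (fst p), omega g n (snd p))"
  by (induction n) (simp_all add: product_maps_def)

lemma omega_in_carrier:
  assumes "nonautonomous_system X d f" "x \<in> X"
  shows "omega f n x \<in> X"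
proof (induction n)
  case (Suc n)
  have "f (Suc n) ` X = X"
    using assms(1) by (simp add: nonautonomous_system_def)
  with Suc show ?case by auto
qed (simp add: assms)

text \<open>Heine-Cantor on the compact carrier.\<close>

lemma nonautonomous_system_uniformly_continuous:
  assumes "nonautonomous_system X d f" "n \<ge> 1" "\<epsilon> > 0"
  obtains \<delta> where "\<delta> > 0"
    and "\<And>a b. a \<in> X \<Longrightarrow> b \<in> X \<Longrightarrow> d a b < \<delta> \<Longrightarrow> d (f n a) (f n b) < \<epsilon>"
proof -
  interpret Metric_space X d
    using assms(1) by (simp add: nonautonomous_system_def)
  have "uniformly_continuous_map Self Self (f n)"
    using assms(1,2)
    by (intro continuous_eq_uniformly_continuous_map[THEN iffD1])
      (simp_all add: nonautonomous_system_def Self_def)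
  then show thesis
    using assms(3) that unfolding uniformly_continuous_map_def by (metis mspace_Self mdist_Self)
qed

text \<open>All late maps are uniformly near \<open>h\<close>, hence near one fixed late map
  \<open>g m\<close>, whose uniform continuity then serves for all of them.\<close>

lemma eventually_equicontinuous:
  assumes "nonautonomous_system Y d g" "h \<in> Y \<rightarrow> Y" "converges_uniformly Y d g h" "\<epsilon> > 0"
  obtains \<delta> N where "\<delta> > 0"
    and "\<And>n a b. n \<ge> N \<Longrightarrow> a \<in> Y \<Longrightarrow> b \<in> Y \<Longrightarrow> d a b < \<delta> \<Longrightarrow> d (g n a) (g n b) < \<epsilon>"
proof -
  interpret Metric_space Y d
    using assms(1) by (simp add: nonautonomous_system_def)
  \<comment> \<open>The chain \<open>g n a\<close>, \<open>h a\<close>, \<open>g m a\<close>,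
    \<open>g m b\<close>, \<open>h b\<close>, \<open>g n b\<close> has five links.\<close>
  obtain N where N: "\<And>n y. n \<ge> N \<Longrightarrow> y \<in> Y \<Longrightarrow> d (g n y) (h y) < \<epsilon> / 5"
    using assms(3,4) unfolding converges_uniformly_def eventually_sequentially
    by (metis divide_pos_pos zero_less_numeral)
  \<comment> \<open>The value \<open>g 0\<close> is unconstrained, so the index must be at least
    1.\<close>
  define m where "m = max 1 N"
  obtain \<delta> where \<delta>: "\<delta> > 0"
      "\<And>a b. a \<in> Y \<Longrightarrow> b \<in> Y \<Longrightarrow> d a b < \<delta> \<Longrightarrow> d (g m a) (g m b) < \<epsilon> / 5"
    using nonautonomous_system_uniformly_continuous[OF assms(1), of m "\<epsilon> / 5"] assms(4)
    unfolding m_def by (metis divide_pos_pos max.cobounded1 zero_less_numeral)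
  have "d (g n a) (g n b) < \<epsilon>" if "n \<ge> m" "a \<in> Y" "b \<in> Y" "d a b < \<delta>" for n a b
  proof -
    have Y: "g k y \<in> Y" if "k \<ge> m" "y \<in> Y" for k y
      using assms(1) that unfolding nonautonomous_system_def m_def by auto
    have in_Y: "g n a \<in> Y" "g n b \<in> Y" "g m a \<in> Y" "g m b \<in> Y" "h a \<in> Y" "h b \<in> Y"
      using Y that assms(2) by auto
    have "d (g n a) (h a) < \<epsilon> / 5" "d (h a) (g m a) < \<epsilon> / 5" "d (g m a) (g m b) < \<epsilon> / 5"
        "d (g m b) (h b) < \<epsilon> / 5" "d (h b) (g n b) < \<epsilon> / 5"
      using N that \<delta> by (simp_all add: m_def commute[of "h _"])
    then show ?thesis
      using triangle[of "g n a" "h a" "g n b"] triangle[of "h a" "g m a" "g n b"]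
        triangle[of "g m a" "g m b" "g n b"] triangle[of "g m b" "h b" "g n b"] in_Y
      by linarith
  qed
  then show thesis
    using \<delta>(1) that by blast
qed

text \<open>Induction on the horizon \<open>L\<close>: the closeness that suffices for
  \<open>L\<close> steps becomes the target that equicontinuity must reach in one step.\<close>

lemma eventually_orbits_stay_close:
  assumes "nonautonomous_system Y d g" "h \<in> Y \<rightarrow> Y" "converges_uniformly Y d g h"
    and "a \<in> Y" "b \<in> Y" "\<epsilon> > 0"
  shows "\<exists>\<delta>>0. \<exists>N. \<forall>n\<ge>N. d (omega g n a) (omega g n b) < \<delta> \<longrightarrow>
           (\<forall>i\<le>L. d (omega g (n + i) a) (omega g (n + i) b) < \<epsilon>)"
proof (induction L)
  case 0
  show ?case using assms(6) by auto
next
  case (Suc L)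
  obtain \<delta> N where \<delta>: "\<delta> > 0" and N: "\<And>n. n \<ge> N \<Longrightarrow> d (omega g n a) (omega g n b) < \<delta> \<Longrightarrow>
      \<forall>i\<le>L. d (omega g (n + i) a) (omega g (n + i) b) < \<epsilon>"
    using Suc by blast
  obtain \<eta> K where \<eta>: "\<eta> > 0"
    and K: "\<And>n x y. n \<ge> K \<Longrightarrow> x \<in> Y \<Longrightarrow> y \<in> Y \<Longrightarrow> d x y < \<eta> \<Longrightarrow> d (g n x) (g n y) < \<delta>"
    using eventually_equicontinuous[OF assms(1-3) \<delta>] by blast
  \<comment> \<open>In the minimum, \<epsilon> settles \<open>i = 0\<close>, while \<eta> makes the
    orbits \<delta>-close at time \<open>Suc n\<close>, from which the remaining steps follow by
    induction.\<close>
  have "d (omega g (n + i) a) (omega g (n + i) b) < \<epsilon>"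
    if n: "n \<ge> max N K" and close: "d (omega g n a) (omega g n b) < min \<eta> \<epsilon>" and "i \<le> Suc L" for n i
  proof (cases i)
    case 0
    then show ?thesis using close by simp
  next
    case (Suc j)
    have "d (omega g (Suc n) a) (omega g (Suc n) b) < \<delta>"
      using K[of "Suc n" "omega g n a" "omega g n b"] n close
        omega_in_carrier[OF assms(1,4)] omega_in_carrier[OF assms(1,5)] by simp
    then show ?thesis
      using N[of "Suc n"] n \<open>i \<le> Suc L\<close> Suc by auto
  qed
  then show ?case
    using \<eta> assms(6) by (intro exI[of _ "min \<eta> \<epsilon>"] conjI exI[of _ "max N K"]) auto
qed

theorem corollary4p1:
  fixes X :: "'a set" and dX :: "'a \<Rightarrow> 'a \<Rightarrow> real" and f :: "nat \<Rightarrow> 'a \<Rightarrow> 'a"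
    and Y :: "'b set" and dY :: "'b \<Rightarrow> 'b \<Rightarrow> real" and g :: "nat \<Rightarrow> 'b \<Rightarrow> 'b"
    and h :: "'b \<Rightarrow> 'b"
  assumes "nonautonomous_system X dX f"
    and "nonautonomous_system Y dY g"
    and "h \<in> Y \<rightarrow> Y"
    and "converges_uniformly Y dY g h"
  shows "\<forall>x\<^sub>1\<in>X. \<forall>x\<^sub>2\<in>X. \<forall>y\<^sub>1\<in>Y. \<forall>y\<^sub>2\<in>Y.
    ((x\<^sub>1, x\<^sub>2), (y\<^sub>1, y\<^sub>2)) \<in> synd_proximal X dX f \<times> synd_proximal Y dY g \<longleftrightarrow>
    ((x\<^sub>1, y\<^sub>1), (x\<^sub>2, y\<^sub>2)) \<in>
      synd_proximal (X \<times> Y) (max_dist dX dY) (product_maps f g)"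
proof (intro ballI)
  fix x\<^sub>1 x\<^sub>2 y\<^sub>1 y\<^sub>2
  assume x: "x\<^sub>1 \<in> X" "x\<^sub>2 \<in> X" and y: "y\<^sub>1 \<in> Y" "y\<^sub>2 \<in> Y"
  define A where "A \<epsilon> = {n. 1 \<le> n \<and> dX (omega f n x\<^sub>1) (omega f n x\<^sub>2) < \<epsilon>}" for \<epsilon>
  define B where "B \<epsilon> = {n. 1 \<le> n \<and> dY (omega g n y\<^sub>1) (omega g n y\<^sub>2) < \<epsilon>}" for \<epsilon>
  have "syndetic (A \<epsilon> \<inter> B \<epsilon>)"
    if A: "\<And>\<epsilon>. \<epsilon> > 0 \<Longrightarrow> syndetic (A \<epsilon>)" and B: "\<And>\<epsilon>. \<epsilon> > 0 \<Longrightarrow> syndetic (B \<epsilon>)" and "\<epsilon> > 0" for \<epsilon>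
  proof -
    obtain L where L: "\<And>k. \<exists>n\<in>A \<epsilon>. k \<le> n \<and> n \<le> k + L"
      using syndetic_bounded_gaps[OF A[OF \<open>\<epsilon> > 0\<close>]] by blast
    obtain \<delta> N where "\<delta> > 0" and N: "\<And>n i. n \<ge> N \<Longrightarrow> dY (omega g n y\<^sub>1) (omega g n y\<^sub>2) < \<delta> \<Longrightarrow>
        i \<le> L \<Longrightarrow> dY (omega g (n + i) y\<^sub>1) (omega g (n + i) y\<^sub>2) < \<epsilon>"
      using eventually_orbits_stay_close[OF assms(2-4) y \<open>\<epsilon> > 0\<close>, of L] by blast
    obtain M where M: "\<And>k. \<exists>n\<in>B \<delta>. k \<le> n \<and> n \<le> k + M"
      using syndetic_bounded_gaps[OF B[OF \<open>\<delta> > 0\<close>]] by blast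
    \<comment> \<open>At most \<open>M\<close> steps lead to a \<delta>-close time in
      \<open>Y\<close>, and at most \<open>L\<close> more to a return time in
      \<open>X\<close>.\<close>
    show ?thesis
    proof (rule syndetic_if_eventually_bounded_gaps[where N = N and M = "M + L"])
      fix k assume "k \<ge> N"
      obtain n where n: "n \<in> B \<delta>" "k \<le> n" "n \<le> k + M"
        using M by blast
      obtain m where m: "m \<in> A \<epsilon>" "n \<le> m" "m \<le> n + L"
        using L by blast
      have "m \<in> B \<epsilon>"
        using N[of n "m - n"] n m \<open>k \<ge> N\<close> by (simp add: A_def B_def)
      then show "\<exists>m\<in>A \<epsilon> \<inter> B \<epsilon>. k \<le> m \<and> m \<le> k + (M + L)"
        using n m by (intro bexI[of _ m]) auto
    qed
  qed
  then have "(\<forall>\<epsilon>>0. syndetic (A \<epsilon>)) \<and> (\<forall>\<epsilon>>0. syndetic (B \<epsilon>)) \<longleftrightarrow>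
      (\<forall>\<epsilon>>0. syndetic (A \<epsilon> \<inter> B \<epsilon>))"
    \<comment> \<open>The backward direction holds because \<open>A \<epsilon>\<close> and
      \<open>B \<epsilon>\<close> both contain the intersection.\<close>
    by (meson Int_lower1 Int_lower2 syndetic_mono)
  moreover have "A \<epsilon> \<inter> B \<epsilon> = {n. 1 \<le> n \<and> max_dist dX dY
      (omega (product_maps f g) n (x\<^sub>1, y\<^sub>1)) (omega (product_maps f g) n (x\<^sub>2, y\<^sub>2)) < \<epsilon>}" for \<epsilon>
    by (auto simp: A_def B_def max_dist_def omega_product_maps)
  ultimately show "((x\<^sub>1, x\<^sub>2), (y\<^sub>1, y\<^sub>2)) \<in> synd_proximal X dX f \<times> synd_proximal Y dY g \<longleftrightarrow>
    ((x\<^sub>1, y\<^sub>1), (x\<^sub>2, y\<^sub>2)) \<in> synd_proximal (X \<times> Y) (max_dist dX dY) (product_maps f g)"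
    using x y by (simp add: synd_proximal_def A_def B_def)
qed

end
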